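(* Let $(\mathcal{S},w)$ be a weighted combinatorial structure on whose objects a notion of size is defined, with finitely many objects of each size, and let $m\ge 1$ be an integer. For $T\subseteq [m]=\{1,2,\ldots,m\}$, let $G_T(x)$ be the generating function, with respect to the size, of the objects of $\mathcal{S}$ which do not contain any piece having weight $i$, for all $i\in T$. Then the generating function $\Gamma_m(x)$, with respect to the size, of the objects of $\mathcal{S}$ having $\mathrm{mex}$ equal to $m$ is $$\Gamma_m(x)=\sum_{k=1}^{m}(-1)^{k+1}\sum_{\substack{T\subseteq [m]\\ |T|=k,\ m\in T}}G_T(x).$$
   Context: A combinatorial structure $\mathcal{S}$ consists of a set $E(\mathcal{S})$ of pieces, a set of instances $I(\mathcal{S})$ constructed from $E(\mathcal{S})$ by standard set-theoretic operations, and a list of properties; the objects of $\mathcal{S}$ are the instances satisfying the properties. For an object $X$ and a piece $e$, write $e\vdash X$ ("$e$ is contained in $X$") if $e$ is among the pieces used in the construction of $X$. (For the present purpose, the data are: a set $\mathcal{S}$ of objects, a set $E(\mathcal{S})$ of pieces, and a containment relation $\vdash$ between pieces and objects.) A weight is any map $w:E(\mathcal{S})\to\mathbf{N}=\{0,1,2,\ldots\}$; the pair $(\mathcal{S},w)$ is a weighted combinatorial structure. The size is a map from $\mathcal{S}$ to $\mathbf{N}$; $\mathcal{S}_n$ is the set of objects of size $n$, and the generating function with respect to the size of a class $\mathcal{A}\subseteq\mathcal{S}$ is the formal power series $\sum_{n\ge 0}|\mathcal{A}\cap\mathcal{S}_n|x^n$. For an object $X$, $\mathrm{mex}(X)$ is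 the minimum positive integer $k$ such that $X$ contains no piece of weight $k$; thus $\mathrm{mex}(X)=m$ if and only if $X$ contains a piece of weight $i$ for each $i=1,\ldots,m-1$ and contains no piece of weight $m$. *)

theory Defs
  imports "HOL-Computational_Algebra.Formal_Power_Series"
begin

text \<open>
  A weighted combinatorial structure is given by a set \<open>S\<close> of objects, a set \<open>E\<close> of pieces,
  a containment relation \<open>inc\<close> (\<open>inc e X\<close> reads ``the piece \<open>e\<close> is contained in the
  object \<open>X\<close>'') and a weight \<open>w\<close>. Only the values of \<open>inc\<close> and \<open>w\<close> on \<open>E\<close> matter.
\<close>

definition has_piece_of_weight ::
  "'e set \<Rightarrow> ('e \<Rightarrow> 'a \<Rightarrow> bool) \<Rightarrow> ('e \<Rightarrow> nat) \<Rightarrow> 'a \<Rightarrow> nat \<Rightarrow> bool" where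
  "has_piece_of_weight E inc w X k \<longleftrightarrow> (\<exists>e\<in>E. inc e X \<and> w e = k)"

text \<open>
  The value is \<open>None\<close> for an object containing pieces of every positive weight: such an object
  has no mex, so it must not be counted for any \<open>m\<close>.
\<close>

definition mex ::
  "'e set \<Rightarrow> ('e \<Rightarrow> 'a \<Rightarrow> bool) \<Rightarrow> ('e \<Rightarrow> nat) \<Rightarrow> 'a \<Rightarrow> nat option" where
  "mex E inc w X =
     (if \<exists>k\<ge>1. \<not> has_piece_of_weight E inc w X k
      then Some (LEAST k. k \<ge> 1 \<and> \<not> has_piece_of_weight E inc w X k)
      else None)"

definition gen_fun :: "('a \<Rightarrow> nat) \<Rightarrow> 'a set \<Rightarrow> int fps" where
  "gen_fun sz A = Abs_fps (\<lambda>n. int (card {X \<in> A. sz X = n}))"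

definition avoiding ::
  "'a set \<Rightarrow> 'e set \<Rightarrow> ('e \<Rightarrow> 'a \<Rightarrow> bool) \<Rightarrow> ('e \<Rightarrow> nat) \<Rightarrow> nat set \<Rightarrow> 'a set" where
  "avoiding S E inc w T = {X \<in> S. \<forall>i\<in>T. \<not> has_piece_of_weight E inc w X i}"

end

theory Submission
  imports Defs
begin

text \<open>
  An object has mex \<open>m\<close> precisely when it avoids the weight \<open>m\<close> and contains every weight in
  \<open>{1..<m}\<close>. Write \<open>a i\<close> for the indicator of the event that the object avoids weight \<open>i\<close>; the
  indicator of having mex \<open>m\<close> is then \<open>a m * (\<Prod>i\<in>{1..<m}. 1 - a i)\<close>. Expanding the product
  (lemma \<open>of_bool_mex_eq\<close>) gives one term for each \<open>U \<subseteq> {1..<m}\<close>, namely \<open>(-1) ^ card U\<close>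
  times the indicator of avoiding every weight in \<open>T = insert m U\<close>. These \<open>T\<close> are exactly the
  subsets of \<open>{1..m}\<close> that contain \<open>m\<close>, and the sign is \<open>(-1) ^ (card T + 1)\<close>.

  Summing this pointwise identity over the finitely many objects of size \<open>n\<close> turns each
  indicator into the \<open>n\<close>-th coefficient of a generating function (lemma \<open>gen_fun_nth_eq_sum\<close>).
  Collecting the sets \<open>T\<close> by cardinality gives the stated double sum.
\<close>

unbundle fps_syntax

lemma mex_eq_Some_iff:
  assumes "m \<ge> 1"
  shows "mex E inc w X = Some m \<longleftrightarrow>
    \<not> has_piece_of_weight E inc w X m \<and> (\<forall>i\<in>{1..<m}. has_piece_of_weight E inc w X i)"
    (is "?L \<longleftrightarrow> ?R")
proof
  let ?P = "\<lambda>k. k \<ge> 1 \<and> \<not> has_piece_of_weight E inc w X k"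
  assume ?L
  then have "Ex ?P" and m: "m = (LEAST k. ?P k)"
    by (auto simp: mex_def split: if_splits)
  then have "?P m"
    using LeastI_ex[of ?P] by simp
  moreover have "\<not> ?P i" if "i < m" for i
    using that not_less_Least[of i ?P] m by simp
  ultimately show ?R
    by auto
next
  let ?P = "\<lambda>k. k \<ge> 1 \<and> \<not> has_piece_of_weight E inc w X k"
  assume R: ?R
  then have "(LEAST k. ?P k) = m"
    using assms by (intro Least_equality) (auto simp: not_less[symmetric])
  then show ?L
    using R assms by (auto simp: mex_def)
qed

lemma prod_of_bool_eq:
  assumes "finite A"
  shows "(\<Prod>i\<in>A. of_bool (P i)) = (of_bool (\<forall>i\<in>A. P i) :: 'b::comm_semiring_1)"
  using assms by (induction A rule: finite_induct) auto

text \<open>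
  Inclusion-exclusion for a single object: the product of the factors \<open>1 - a i\<close> is expanded, and
  the common factor \<open>a m\<close> is absorbed by adjoining \<open>m\<close> to each index set. This raises the
  cardinality by one, hence the exponent \<open>card T + 1\<close>, which has the parity of \<open>card (T - {m})\<close>.
\<close>

lemma of_bool_mex_eq:
  assumes "m \<ge> 1"
  shows "(of_bool (mex E inc w X = Some m) :: int) =
    (\<Sum>T | T \<subseteq> {1..m} \<and> m \<in> T.
      (-1) ^ (card T + 1) * of_bool (\<forall>i\<in>T. \<not> has_piece_of_weight E inc w X i))"
proof -
  let ?a = "\<lambda>i. \<not> has_piece_of_weight E inc w X i"
  have "(of_bool (mex E inc w X = Some m) :: int)
      = of_bool (?a m) * of_bool (\<forall>i\<in>{1..<m}. \<not> ?a i)"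
    by (simp add: mex_eq_Some_iff[OF assms])
  also have "\<dots> = of_bool (?a m) * (\<Prod>i\<in>{1..<m}. 1 - of_bool (?a i))"
    by (simp add: prod_of_bool_eq flip: of_bool_not_iff)
  also have "\<dots> = (\<Sum>U\<in>Pow {1..<m}. of_bool (?a m) * ((-1) ^ card U * of_bool (\<forall>i\<in>U. ?a i)))"
    unfolding prod_diff_conv_sum[OF finite_atLeastLessThan] sum_distrib_left
    by (intro sum.cong refl) (auto simp: prod_of_bool_eq finite_subset[OF _ finite_atLeastLessThan])
  also have "\<dots> = (\<Sum>T | T \<subseteq> {1..m} \<and> m \<in> T. (-1) ^ (card T + 1) * of_bool (\<forall>i\<in>T. ?a i))"
  proof (rule sum.reindex_bij_witness[where i = "\<lambda>T. T - {m}" and j = "insert m"])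
    fix U assume U: "U \<in> Pow {1..<m}"
    then have "finite U" "m \<notin> U"
      using finite_subset by auto
    then show "(-1) ^ (card (insert m U) + 1) * of_bool (\<forall>i\<in>insert m U. ?a i)
        = of_bool (?a m) * ((-1) ^ card U * (of_bool (\<forall>i\<in>U. ?a i) :: int))"
      by simp
    show "insert m U \<in> {T. T \<subseteq> {1..m} \<and> m \<in> T}"
      using U assms by auto
    show "insert m U - {m} = U"
      using \<open>m \<notin> U\<close> by simp
  next
    fix T assume T: "T \<in> {T. T \<subseteq> {1..m} \<and> m \<in> T}"
    then show "insert m (T - {m}) = T"
      by auto
    show "T - {m} \<in> Pow {1..<m}"
    proof
      show "T - {m} \<subseteq> {1..<m}"
        using T by (auto simp: less_le)
    qed
  qed
  finally show ?thesis .
qed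

text \<open>
  The coefficients for different properties become sums over one common index set, so that a
  linear identity between indicators passes to the generating functions.
\<close>

lemma gen_fun_nth_eq_sum:
  assumes "finite {X \<in> S. sz X = n}"
  shows "gen_fun sz {X \<in> S. P X} $ n = (\<Sum>X | X \<in> S \<and> sz X = n. of_bool (P X))"
proof -
  have "{X \<in> {X \<in> S. P X}. sz X = n} = {X \<in> S. sz X = n} \<inter> {X. P X}"
    by auto
  then show ?thesis
    using assms by (simp add: gen_fun_def)
qed

theorem theorem2p1:
  fixes S :: "'a set"
    and E :: "'e set"
    and inc :: "'e \<Rightarrow> 'a \<Rightarrow> bool"
    and w :: "'e \<Rightarrow> nat"
    and sz :: "'a \<Rightarrow> nat"
    and m :: nat
  assumes "\<And>n. finite {X \<in> S. sz X = n}"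
    and "m \<ge> 1"
  shows "gen_fun sz {X \<in> S. mex E inc w X = Some m} =
    (\<Sum>k = 1..m. (-1) ^ (k + 1) *
      (\<Sum>T | T \<subseteq> {1..m} \<and> card T = k \<and> m \<in> T. gen_fun sz (avoiding S E inc w T)))"
proof -
  let ?G = "\<lambda>T. gen_fun sz (avoiding S E inc w T)"
  let ?\<T> = "{T. T \<subseteq> {1..m} \<and> m \<in> T}"
  let ?\<T>k = "\<lambda>k. {T. T \<subseteq> {1..m} \<and> card T = k \<and> m \<in> T}"
  have fin: "finite ?\<T>"
    by (rule finite_subset[of _ "Pow {1..m}"]) auto
  have sign_nth: "((-1) ^ j * F) $ n = (-1) ^ j * F $ n" for j n and F :: "int fps"
    by (cases "even j") auto
  have "gen_fun sz {X \<in> S. mex E inc w X = Some m} = (\<Sum>T\<in>?\<T>. (-1) ^ (card T + 1) * ?G T)"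
  proof (rule fps_ext)
    fix n
    let ?Sn = "{X. X \<in> S \<and> sz X = n}"
    have "gen_fun sz {X \<in> S. mex E inc w X = Some m} $ n
        = (\<Sum>X\<in>?Sn. \<Sum>T\<in>?\<T>. (-1) ^ (card T + 1) *
            of_bool (\<forall>i\<in>T. \<not> has_piece_of_weight E inc w X i))"
      by (simp only: gen_fun_nth_eq_sum[OF assms(1)] of_bool_mex_eq[OF assms(2)])
    also have "\<dots> = (\<Sum>T\<in>?\<T>. (-1) ^ (card T + 1) *
        (\<Sum>X\<in>?Sn. of_bool (\<forall>i\<in>T. \<not> has_piece_of_weight E inc w X i)))"
      by (subst sum.swap) (simp only: sum_distrib_left)
    also have "\<dots> = (\<Sum>T\<in>?\<T>. (-1) ^ (card T + 1) * ?G T) $ n"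
      by (simp only: fps_sum_nth sign_nth avoiding_def gen_fun_nth_eq_sum[OF assms(1)])
    finally show "gen_fun sz {X \<in> S. mex E inc w X = Some m} $ n
        = (\<Sum>T\<in>?\<T>. (-1) ^ (card T + 1) * ?G T) $ n" .
  qed
  also have "\<dots> = (\<Sum>k = 1..m. \<Sum>T | T \<in> ?\<T> \<and> card T = k. (-1) ^ (card T + 1) * ?G T)"
  proof (rule sum.group[symmetric, OF fin])
    \<comment> \<open>The cardinality is at least \<open>1\<close> because \<open>m \<in> T\<close>.\<close>
    show "card ` ?\<T> \<subseteq> {1..m}"
    proof clarify
      fix T assume T: "T \<subseteq> {1..m}" "m \<in> T"
      then have "finite T"
        using finite_subset by blast
      then have "card T \<noteq> 0"
        using T by auto
      moreover have "card T \<le> m"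
        using card_mono[OF finite_atLeastAtMost T(1)] by simp
      ultimately show "card T \<in> {1..m}"
        by simp
    qed
  qed simp
  also have "\<dots> = (\<Sum>k = 1..m. (-1) ^ (k + 1) * (\<Sum>T\<in>?\<T>k k. ?G T))"
    unfolding sum_distrib_left by (intro sum.cong) auto
  finally show ?thesis .
qed

end
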